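(* Let $\mathcal G=(\mathcal V,\mathcal E)$ be a simple directed graph on $n$ nodes in which every node has out-degree at least one, let $\alpha\in(0,1)$, $\epsilon>0$, $s\in\mathcal V$, and let $\bm x^*$ be the personalized PageRank vector of $s$, i.e. the unique solution of $\bm x=\alpha\bm e_s+(1-\alpha)\bm A^\top\bm D^{-1}\bm x$. Run \textsc{FwdPush}$(\mathcal G,\epsilon,\alpha,s)$ with epochs (defined in the context), and let $\bm x^t,\bm r^t$ be the estimation and residual vectors at the beginning of epoch $t$ (so $\bm x^0=\bm 0$, $\bm r^0=\bm e_s$). Then for all $t\ge 0$, $$\|\bm x^{t+1}-\bm x^*\|_1\le(1-\alpha\gamma_t)\|\bm x^t-\bm x^*\|_1,\qquad \gamma_t:=\frac{\sum_{u\in\mathcal S_t}d_u}{\sum_{v\in\mathcal I_t}d_v}.$$ Furthermore, if $T$ is the total number of epochs, the total work satisfies $$\sum_{t=1}^T\operatorname{vol}(\mathcal S_t)\le\frac{\operatorname{vol}(\mathcal S_{1:T})}{\alpha\,\gamma_{1:T}}\log\Big(\frac{C_{\alpha,T}}{\epsilon}\Big),$$ where $\operatorname{vol}(\mathcal S_{1:T})=\frac1T\sum_{t=1}^T\operatorname{vol}(\mathcal S_t)$, $\gamma_{1:T}=\frac1T\sum_{t=1}^T\gamma_t$, and $C_{\alpha,T}=1/((1-\alpha)|\mathcal I_T|)$.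
   Context: $\bm A$ is the adjacency matrix and $\bm D=\mathrm{diag}(d_1,\dots,d_n)$ the out-degree matrix of $\mathcal G$; $\operatorname{vol}(\mathcal S)=\sum_{v\in\mathcal S}d_v$. \textsc{FwdPush}$(\mathcal G,\epsilon,\alpha,s)$: start with $\bm x=\bm 0$, $\bm r=\bm e_s$, FIFO queue $\mathcal Q=[s,\ddagger]$ where $\ddagger$ is a dummy node. While $\mathcal Q$ contains more than the dummy: pop $u$; if $u=\ddagger$, re-append it and start a new epoch; otherwise set $x_u\leftarrow x_u+\alpha r_u$, for each out-neighbor $v$ of $u$ set $r_v\leftarrow r_v+(1-\alpha)r_u/d_u$ and append $v$ to $\mathcal Q$ if $r_v\ge\epsilon d_v$ and $v\notin\mathcal Q$, then set $r_u\leftarrow 0$. At the beginning of epoch $t$: $\mathcal S_t=\{u: r^t_u\ge\epsilon d_u\}$ is the set of active nodes (exactly the nodes processed in epoch $t$), $\mathcal U_t=\{v:0<r^t_v<\epsilon d_v\}$ is the set of inactive nodes, and $\mathcal I_t=\operatorname{supp}(\bm r^t)$. $\mathcal I_T$ is the support of the residual vector at the last epoch $T$. *)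

theory Defs
  imports "HOL-Analysis.Analysis" "Graph_Theory.Digraph"
begin

section \<open>Personalized PageRank\<close>

text \<open>
  The nodes of the graph are the elements of a finite type \<open>'n\<close>, so vectors and matrices are
  \<^typ>\<open>real^'n\<close> and \<^typ>\<open>real^'n^'n\<close>. A simple directed graph is a graph satisfying the locale
  \<^locale>\<open>digraph\<close>: finite, without loops and without parallel arcs.
\<close>

definition adjacency :: "('n::finite, 'b) pre_digraph \<Rightarrow> real^'n^'n" where
  "adjacency G = (\<chi> u v. if u \<rightarrow>\<^bsub>G\<^esub> v then 1 else 0)"

definition degree_matrix :: "('n::finite, 'b) pre_digraph \<Rightarrow> real^'n^'n" where
  "degree_matrix G = (\<chi> u v. if u = v then real (out_degree G u) else 0)"

definition vol :: "('n::finite, 'b) pre_digraph \<Rightarrow> 'n set \<Rightarrow> real" where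
  "vol G S = (\<Sum>v\<in>S. real (out_degree G v))"

definition l1_norm :: "real^'n \<Rightarrow> real" where
  "l1_norm x = (\<Sum>i\<in>UNIV. \<bar>x $ i\<bar>)"

definition ppr_equation :: "('n::finite, 'b) pre_digraph \<Rightarrow> real \<Rightarrow> 'n \<Rightarrow> real^'n \<Rightarrow> bool" where
  "ppr_equation G \<alpha> s x \<longleftrightarrow>
     x = \<alpha> *\<^sub>R axis s 1
         + (1 - \<alpha>) *\<^sub>R ((transpose (adjacency G) ** matrix_inv (degree_matrix G)) *v x)"

definition ppr :: "('n::finite, 'b) pre_digraph \<Rightarrow> real \<Rightarrow> 'n \<Rightarrow> real^'n" where
  "ppr G \<alpha> s = (THE x. ppr_equation G \<alpha> s x)"


section \<open>Forward push\<close>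

text \<open>
  The order in which the out-neighbours of a node are visited influences the order of the queue;
  it is given by an arbitrary adjacency-list representation of the graph.
\<close>

definition adjacency_lists :: "('n, 'b) pre_digraph \<Rightarrow> ('n \<Rightarrow> 'n list) \<Rightarrow> bool" where
  "adjacency_lists G nbrs \<longleftrightarrow> (\<forall>u. distinct (nbrs u) \<and> set (nbrs u) = {v. u \<rightarrow>\<^bsub>G\<^esub> v})"

text \<open>
  The queue contains \<^term>\<open>Some u\<close> for a node \<open>u\<close> and \<^term>\<open>None\<close> for the dummy node; its head is
  the next element to be popped. Epochs are numbered from 0.
\<close>

record ('n::finite) push_state =
  est :: "real^'n"
  res :: "real^'n"
  queue :: "'n option list"
  epoch :: nat

definition init_state :: "'n::finite \<Rightarrow> 'n push_state" where
  "init_state s = \<lparr>est = 0, res = axis s 1, queue = [Some s, None], epoch = 0\<rparr>"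

definition halted :: "('n::finite) push_state \<Rightarrow> bool" where
  "halted \<sigma> \<longleftrightarrow> queue \<sigma> = [None]"

definition relax ::
  "('n::finite, 'b) pre_digraph \<Rightarrow> real \<Rightarrow> real \<Rightarrow> 'n \<Rightarrow> 'n \<Rightarrow> 'n push_state \<Rightarrow> 'n push_state" where
  "relax G \<epsilon> \<alpha> u v \<sigma> =
     (let r = res \<sigma> + axis v ((1 - \<alpha>) * res \<sigma> $ u / real (out_degree G u))
      in \<sigma>\<lparr>res := r,
           queue := (if r $ v \<ge> \<epsilon> * real (out_degree G v) \<and> Some v \<notin> set (queue \<sigma>)
                     then queue \<sigma> @ [Some v] else queue \<sigma>)\<rparr>)"

definition push_node ::
  "('n::finite, 'b) pre_digraph \<Rightarrow> ('n \<Rightarrow> 'n list) \<Rightarrow> real \<Rightarrow> real \<Rightarrow> 'n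
     \<Rightarrow> 'n push_state \<Rightarrow> 'n push_state" where
  "push_node G nbrs \<epsilon> \<alpha> u \<sigma> =
     (let \<sigma>1 = \<sigma>\<lparr>est := est \<sigma> + axis u (\<alpha> * res \<sigma> $ u)\<rparr>;
          \<sigma>2 = fold (relax G \<epsilon> \<alpha> u) (nbrs u) \<sigma>1
      in \<sigma>2\<lparr>res := (\<chi> w. if w = u then 0 else res \<sigma>2 $ w)\<rparr>)"

definition push_step ::
  "('n::finite, 'b) pre_digraph \<Rightarrow> ('n \<Rightarrow> 'n list) \<Rightarrow> real \<Rightarrow> real
     \<Rightarrow> 'n push_state \<Rightarrow> 'n push_state" where
  "push_step G nbrs \<epsilon> \<alpha> \<sigma> =
     (if halted \<sigma> then \<sigma>
      else case queue \<sigma> of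
             [] \<Rightarrow> \<sigma>
           | None # q \<Rightarrow> \<sigma>\<lparr>queue := q @ [None], epoch := Suc (epoch \<sigma>)\<rparr>
           | Some u # q \<Rightarrow> push_node G nbrs \<epsilon> \<alpha> u (\<sigma>\<lparr>queue := q\<rparr>))"

definition push_run ::
  "('n::finite, 'b) pre_digraph \<Rightarrow> ('n \<Rightarrow> 'n list) \<Rightarrow> real \<Rightarrow> real \<Rightarrow> 'n
     \<Rightarrow> nat \<Rightarrow> 'n push_state" where
  "push_run G nbrs \<epsilon> \<alpha> s k = (push_step G nbrs \<epsilon> \<alpha> ^^ k) (init_state s)"

text \<open>
  The state at the beginning of epoch \<open>t\<close>. If the algorithm halts before an epoch \<open>t\<close> is started,
  this is the final state; in particular, if \<open>T\<close> epochs \<open>0, \<dots>, T - 1\<close> are executed, then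
  \<open>epoch_state \<dots> T\<close> is the state at the end of the last one.
\<close>

definition epoch_state ::
  "('n::finite, 'b) pre_digraph \<Rightarrow> ('n \<Rightarrow> 'n list) \<Rightarrow> real \<Rightarrow> real \<Rightarrow> 'n
     \<Rightarrow> nat \<Rightarrow> 'n push_state" where
  "epoch_state G nbrs \<epsilon> \<alpha> s t =
     push_run G nbrs \<epsilon> \<alpha> s
       (LEAST k. epoch (push_run G nbrs \<epsilon> \<alpha> s k) = t \<or> halted (push_run G nbrs \<epsilon> \<alpha> s k))"

definition num_epochs ::
  "('n::finite, 'b) pre_digraph \<Rightarrow> ('n \<Rightarrow> 'n list) \<Rightarrow> real \<Rightarrow> real \<Rightarrow> 'n \<Rightarrow> nat" where
  "num_epochs G nbrs \<epsilon> \<alpha> s =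
     Suc (epoch (push_run G nbrs \<epsilon> \<alpha> s (LEAST k. halted (push_run G nbrs \<epsilon> \<alpha> s k))))"

definition active_nodes ::
  "('n::finite, 'b) pre_digraph \<Rightarrow> real \<Rightarrow> real^'n \<Rightarrow> 'n set" where
  "active_nodes G \<epsilon> r = {u. r $ u \<ge> \<epsilon> * real (out_degree G u)}"

definition vec_support :: "real^'n \<Rightarrow> 'n set" where
  "vec_support r = {u. r $ u \<noteq> 0}"

end

theory Submission
  imports Defs
begin

text \<open>
  Forward push keeps \<open>\<alpha> r = \<alpha> e\<^sub>s - (I - (1 - \<alpha>) P) x\<close> with the column-stochastic matrix
  \<open>P = A\<^sup>T D\<^sup>-\<^sup>1\<close>, and it keeps \<open>r\<close> nonnegative. Hence the error \<open>x\<^sup>* - x\<close> has the same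
  \<open>\<ell>\<^sub>1\<close> norm as \<open>r\<close>, and pushing \<open>u\<close> lowers this norm by exactly \<open>\<alpha> r\<^sub>u\<close>. All active nodes are queued
  at the beginning of an epoch, and the residual of a node does not decrease until it is pushed; so
  the epoch removes at least \<open>\<alpha>\<close> times the residual of the active nodes, which is at least the
  fraction \<open>\<gamma>\<^sub>t\<close> of the total.

  If the start node is active, only active nodes are ever pushed, each passing at least
  \<open>(1 - \<alpha>) \<epsilon>\<close> to every out-neighbour; so at the end
  \<open>(1 - \<alpha>) \<epsilon> \<bar>I\<^sub>T\<bar> \<le> \<parallel>r\<^sup>T\<parallel>\<^sub>1 \<le> exp (- \<alpha> \<Sum>\<gamma>\<^sub>t)\<close>, and taking logarithms gives the bound on
  the work. If it is not, the algorithm halts after one push and no active node ever occurs.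
\<close>

section \<open>The PageRank equation\<close>

text \<open>\<open>matrix_inv\<close> is a Hilbert choice; it is identified by exhibiting the
  reciprocal diagonal matrix as an inverse and cancelling with it.\<close>

lemma matrix_inv_degree_matrix:
  fixes G :: "('n::finite, 'b) pre_digraph"
  assumes "\<And>u. out_degree G u \<ge> 1"
  shows "matrix_inv (degree_matrix G) = (\<chi> u v. if u = v then 1 / real (out_degree G u) else 0)"
proof -
  let ?D = "degree_matrix G" and ?E = "(\<chi> u v. if u = v then 1 / real (out_degree G u) else 0) :: real^'n^'n"
  have nz: "out_degree G u > 0" for u
    using assms[of u] by simp
  have DE: "?D ** ?E = mat 1"
    using nz by (simp add: vec_eq_iff matrix_matrix_mult_def degree_matrix_def mat_def
        mult_delta_left mult_delta_right)
  then have ED: "?E ** ?D = mat 1"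
    by (simp add: matrix_left_right_inverse)
  have "?D ** matrix_inv ?D = mat 1"
    unfolding matrix_inv_def by (rule someI2[where a = ?E]) (use DE ED in auto)
  then have "?E ** (?D ** matrix_inv ?D) = ?E"
    by simp
  then show ?thesis
    unfolding matrix_mul_assoc ED by simp
qed

lemma axis_nth: "axis i x $ j = (if j = i then x else 0)"
  by (simp add: axis_def)

lemma l1_norm_add_le: "l1_norm (x + y) \<le> l1_norm x + l1_norm y"
  unfolding l1_norm_def sum.distrib[symmetric] by (auto intro!: sum_mono)

lemma l1_norm_scaleR: "l1_norm (c *\<^sub>R x) = \<bar>c\<bar> * l1_norm x"
  unfolding l1_norm_def by (simp add: abs_mult sum_distrib_left)

lemma l1_norm_eq_0D: "l1_norm x \<le> 0 \<Longrightarrow> x = 0"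
  unfolding l1_norm_def
  by (metis (no_types, lifting) abs_ge_zero abs_eq_0 dual_order.antisym finite sum_nonneg sum_nonneg_eq_0_iff UNIV_I vec_eq_iff zero_index)

locale forward_push = digraph G
  for G :: "('n::finite, 'b) pre_digraph" +
  fixes nbrs :: "'n \<Rightarrow> 'n list" and \<alpha> \<epsilon> :: real and s :: 'n
  assumes out_degree_ge_1: "out_degree G u \<ge> 1"
    and nbrs: "adjacency_lists G nbrs"
    and \<alpha>_pos: "0 < \<alpha>" and \<alpha>_less_1: "\<alpha> < 1" and \<epsilon>_pos: "0 < \<epsilon>"
begin

abbreviation deg :: "'n \<Rightarrow> real" where
  "deg u \<equiv> real (out_degree G u)"

abbreviation mass :: "real^'n \<Rightarrow> real" where
  "mass x \<equiv> \<Sum>v\<in>UNIV. x $ v"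

definition walk :: "real^'n^'n" where
  "walk = transpose (adjacency G) ** matrix_inv (degree_matrix G)"

lemma deg_ge_1: "deg u \<ge> 1"
  using out_degree_ge_1[of u] by simp

lemma deg_pos: "deg u > 0"
  using deg_ge_1[of u] by linarith

lemma distinct_nbrs: "distinct (nbrs u)"
  and set_nbrs: "set (nbrs u) = {v. u \<rightarrow>\<^bsub>G\<^esub> v}"
  and not_in_nbrs: "u \<notin> set (nbrs u)"
  using nbrs adj_not_same[of u] by (auto simp: adjacency_lists_def)

text \<open>Out-degree counts arcs; without parallel arcs the head map is a bijection from the arcs
  leaving \<open>u\<close> to its out-neighbours.\<close>

lemma card_nbrs: "card {v. u \<rightarrow>\<^bsub>G\<^esub> v} = out_degree G u"
proof -
  have "inj_on (head G) (out_arcs G u)"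
    by (auto simp: inj_on_def arc_to_ends_def intro!: no_multi_arcs)
  moreover have "head G ` out_arcs G u = {v. u \<rightarrow>\<^bsub>G\<^esub> v}"
    by (auto simp: arcs_ends_conv out_arcs_def)
  ultimately show ?thesis
    unfolding out_degree_def by (metis card_image)
qed

lemma walk_nth: "walk $ v $ u = (if u \<rightarrow>\<^bsub>G\<^esub> v then 1 / deg u else 0)"
  unfolding walk_def matrix_inv_degree_matrix[OF out_degree_ge_1]
  by (simp add: matrix_matrix_mult_def transpose_def adjacency_def mult_delta_left mult_delta_right)

lemma walk_column_sum: "(\<Sum>v\<in>UNIV. walk $ v $ u) = 1"
  using deg_pos[of u] by (simp add: walk_nth sum.If_cases card_nbrs)

lemma walk_axis: "(walk *v axis u c) $ v = (if u \<rightarrow>\<^bsub>G\<^esub> v then c / deg u else 0)"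
  by (simp add: matrix_vector_mult_def walk_nth axis_def mult_delta_left mult_delta_right)

lemma mass_walk: "mass (walk *v x) = mass x"
proof -
  have "mass (walk *v x) = (\<Sum>u\<in>UNIV. (\<Sum>v\<in>UNIV. walk $ v $ u) * x $ u)"
    unfolding matrix_vector_mult_def
    by (simp add: sum_distrib_right) (rule sum.swap)
  then show ?thesis
    by (simp add: walk_column_sum)
qed

lemma l1_norm_walk_le: "l1_norm (walk *v x) \<le> l1_norm x"
proof -
  have "l1_norm (walk *v x) \<le> mass (walk *v (\<chi> u. \<bar>x $ u\<bar>))"
    unfolding l1_norm_def matrix_vector_mult_def
    by (auto intro!: sum_mono order_trans[OF sum_abs] simp: abs_mult walk_nth)
  then show ?thesis
    unfolding mass_walk by (simp add: l1_norm_def)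
qed

text \<open>\<open>y\<close> is a multiple of the resolvent of \<open>walk\<close> applied to
  \<open>r\<close>. As \<open>walk\<close> preserves mass and does not increase the norm, its term
  is absorbed on the left and a factor \<alpha> cancels.\<close>

lemma resolvent_l1_norm:
  assumes "y = \<alpha> *\<^sub>R r + (1 - \<alpha>) *\<^sub>R (walk *v y)"
  shows "l1_norm y \<le> l1_norm r" "mass y = mass r"
proof -
  have "l1_norm y \<le> \<alpha> * l1_norm r + (1 - \<alpha>) * l1_norm (walk *v y)"
    using l1_norm_add_le[of "\<alpha> *\<^sub>R r" "(1 - \<alpha>) *\<^sub>R (walk *v y)"] assms \<alpha>_pos \<alpha>_less_1
    by (simp add: l1_norm_scaleR)
  also have "\<dots> \<le> \<alpha> * l1_norm r + (1 - \<alpha>) * l1_norm y"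
    using l1_norm_walk_le \<alpha>_less_1 by (intro add_left_mono mult_left_mono) auto
  finally have "\<alpha> * l1_norm y \<le> \<alpha> * l1_norm r"
    by (simp add: algebra_simps)
  then show "l1_norm y \<le> l1_norm r"
    using \<alpha>_pos by simp
  have "mass y = \<alpha> * mass r + (1 - \<alpha>) * mass (walk *v y)"
    by (subst assms) (simp add: sum.distrib sum_distrib_left)
  then have "\<alpha> * mass y = \<alpha> * mass r"
    unfolding mass_walk by (simp add: algebra_simps)
  then show "mass y = mass r"
    using \<alpha>_pos by simp
qed

text \<open>\<open>ppr\<close> is a definite description, so unique solvability is needed: the norm
  bound with source 0 gives a trivial kernel, and an injective linear endomap in finite dimension is
  onto.\<close>

lemma ppr_equation_ppr: "ppr_equation G \<alpha> s (ppr G \<alpha> s)"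
proof -
  define f where "f x = x - (1 - \<alpha>) *\<^sub>R (walk *v x)" for x :: "real^'n"
  have lin: "linear f"
    unfolding f_def
    by (intro linear_compose_sub linear_compose_scale_right linear_ident matrix_vector_mul_linear)
  have eq: "ppr_equation G \<alpha> s x \<longleftrightarrow> f x = \<alpha> *\<^sub>R axis s 1" for x
    unfolding ppr_equation_def f_def walk_def[symmetric] by (auto simp: algebra_simps)
  have "x = 0" if "f x = 0" for x
  proof (rule l1_norm_eq_0D)
    show "l1_norm x \<le> 0"
      using resolvent_l1_norm(1)[of x 0] that by (simp add: f_def l1_norm_def)
  qed
  then have inj: "inj f"
    using lin by (simp add: linear_injective_0)
  then have "\<exists>!x. f x = \<alpha> *\<^sub>R axis s 1"
    using linear_injective_imp_surjective[OF lin] by (metis injD surjD)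
  then show ?thesis
    unfolding ppr_def eq by (rule theI')
qed

text \<open>The error satisfies the resolvent equation with source \<open>r\<close>. Its norm is at
  most that of \<open>r\<close>, which is \<open>mass r\<close> by nonnegativity, and at least its
  own mass, which is also \<open>mass r\<close>.\<close>

lemma l1_norm_ppr_diff:
  assumes "\<And>v. 0 \<le> r $ v"
    and "\<alpha> *\<^sub>R r = \<alpha> *\<^sub>R axis s 1 - x + (1 - \<alpha>) *\<^sub>R (walk *v x)"
  shows "l1_norm (x - ppr G \<alpha> s) = mass r"
proof -
  define y where "y = ppr G \<alpha> s - x"
  have "ppr G \<alpha> s = \<alpha> *\<^sub>R axis s 1 + (1 - \<alpha>) *\<^sub>R (walk *v ppr G \<alpha> s)"
    using ppr_equation_ppr by (simp add: ppr_equation_def walk_def)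
  then have y: "y = \<alpha> *\<^sub>R r + (1 - \<alpha>) *\<^sub>R (walk *v y)"
    unfolding y_def assms(2) matrix_vector_mult_diff_distrib by (simp add: algebra_simps)
  have "l1_norm y \<le> mass r"
    using resolvent_l1_norm(1)[OF y] assms(1) by (simp add: l1_norm_def)
  moreover have "mass r \<le> l1_norm y"
    unfolding resolvent_l1_norm(2)[OF y, symmetric] l1_norm_def by (intro sum_mono) auto
  moreover have "l1_norm (x - ppr G \<alpha> s) = l1_norm y"
    unfolding y_def l1_norm_def by (intro sum.cong) auto
  ultimately show ?thesis by linarith
qed


section \<open>A single push\<close>

text \<open>\<open>relax\<close> rereads the residual of \<open>u\<close> at every neighbour; as
  \<open>u\<close> is not in \<open>vs\<close>, the share \<open>c\<close> stays the same
  throughout.\<close>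

lemma fold_relax:
  fixes \<sigma> :: "'n push_state"
  assumes "distinct vs" "u \<notin> set vs"
  defines "c \<equiv> (1 - \<alpha>) * res \<sigma> $ u / deg u"
  shows "fold (relax G \<epsilon> \<alpha> u) vs \<sigma> =
    \<sigma>\<lparr>res := (\<chi> w. res \<sigma> $ w + (if w \<in> set vs then c else 0)),
      queue := queue \<sigma> @ map Some (filter (\<lambda>v. \<epsilon> * deg v \<le> res \<sigma> $ v + c \<and> Some v \<notin> set (queue \<sigma>)) vs)\<rparr>"
  using assms(1,2) unfolding c_def
proof (induction vs arbitrary: \<sigma>)
  case Nil
  then show ?case by (simp add: vec_eq_iff)
next
  case (Cons v vs)
  define c where "c = (1 - \<alpha>) * res \<sigma> $ u / deg u"
  define \<sigma>' where "\<sigma>' = relax G \<epsilon> \<alpha> u v \<sigma>"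
  have res': "res \<sigma>' $ w = res \<sigma> $ w + (if w = v then c else 0)" for w
    by (simp add: \<sigma>'_def relax_def Let_def c_def axis_def)
  have queue': "queue \<sigma>' = queue \<sigma> @
      (if \<epsilon> * deg v \<le> res \<sigma> $ v + c \<and> Some v \<notin> set (queue \<sigma>) then [Some v] else [])"
    by (simp add: \<sigma>'_def relax_def Let_def c_def)
  have upd: "\<sigma>'\<lparr>res := R, queue := Q\<rparr> = \<sigma>\<lparr>res := R, queue := Q\<rparr>" for R Q
    by (simp add: \<sigma>'_def relax_def Let_def)
  have c': "(1 - \<alpha>) * res \<sigma>' $ u / deg u = c"
    using Cons.prems(2) by (simp add: res' c_def)
  \<comment> \<open>Handling \<open>v\<close> changes neither the residual nor the queue membership
    of the remaining nodes, which differ from \<open>v\<close>.\<close>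
  have filter': "filter (\<lambda>w. \<epsilon> * deg w \<le> res \<sigma>' $ w + c \<and> Some w \<notin> set (queue \<sigma>')) vs
      = filter (\<lambda>w. \<epsilon> * deg w \<le> res \<sigma> $ w + c \<and> Some w \<notin> set (queue \<sigma>)) vs"
    using Cons.prems(1) by (intro filter_cong) (auto simp: res' queue')
  have "fold (relax G \<epsilon> \<alpha> u) (v # vs) \<sigma> = fold (relax G \<epsilon> \<alpha> u) vs \<sigma>'"
    by (simp add: \<sigma>'_def)
  also have "\<dots> = \<sigma>'\<lparr>res := (\<chi> w. res \<sigma>' $ w + (if w \<in> set vs then c else 0)),
      queue := queue \<sigma>' @ map Some (filter (\<lambda>w. \<epsilon> * deg w \<le> res \<sigma>' $ w + c \<and> Some w \<notin> set (queue \<sigma>')) vs)\<rparr>"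
    using Cons.IH[of \<sigma>'] Cons.prems unfolding c' by simp
  also have "(\<chi> w. res \<sigma>' $ w + (if w \<in> set vs then c else 0))
      = (\<chi> w. res \<sigma> $ w + (if w \<in> set (v # vs) then c else 0))"
    using Cons.prems(1) by (auto simp: vec_eq_iff res')
  also have "queue \<sigma>' @ map Some (filter (\<lambda>w. \<epsilon> * deg w \<le> res \<sigma>' $ w + c \<and> Some w \<notin> set (queue \<sigma>')) vs)
      = queue \<sigma> @ map Some (filter (\<lambda>w. \<epsilon> * deg w \<le> res \<sigma> $ w + c \<and> Some w \<notin> set (queue \<sigma>)) (v # vs))"
    unfolding filter' by (simp add: queue')
  finally show ?case
    unfolding upd c_def .
qed

text \<open>Positive mass keeps the support nonempty and hence the denominator of \<gamma> positive.
  The queue may hold inactive nodes, since the start node is queued unconditionally.\<close>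

definition sound :: "'n push_state \<Rightarrow> bool" where
  "sound \<sigma> \<longleftrightarrow> (\<forall>v. 0 \<le> res \<sigma> $ v) \<and> 0 < mass (res \<sigma>)
     \<and> (\<forall>v\<in>active_nodes G \<epsilon> (res \<sigma>). Some v \<in> set (queue \<sigma>)) \<and> distinct (queue \<sigma>)
     \<and> \<alpha> *\<^sub>R res \<sigma> = \<alpha> *\<^sub>R axis s 1 - est \<sigma> + (1 - \<alpha>) *\<^sub>R (walk *v est \<sigma>)"

text \<open>These stronger properties hold initially only if the start node is active; they serve
  for termination and for the lower bound on the final residual.\<close>

definition tight :: "'n push_state \<Rightarrow> bool" where
  "tight \<sigma> \<longleftrightarrow> (\<forall>v. Some v \<in> set (queue \<sigma>) \<longrightarrow> v \<in> active_nodes G \<epsilon> (res \<sigma>))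
     \<and> (\<forall>v\<in>vec_support (res \<sigma>). (1 - \<alpha>) * \<epsilon> \<le> res \<sigma> $ v)"

abbreviation step :: "'n push_state \<Rightarrow> 'n push_state" where
  "step \<equiv> push_step G nbrs \<epsilon> \<alpha>"

text \<open>Without loops, \<open>u\<close> receives no share from itself and is not queued again by
  its own push, so a push has a closed form.\<close>

lemma step_Some:
  fixes \<sigma> :: "'n push_state"
  assumes \<sigma>: "queue \<sigma> = Some u # q"
  defines "c \<equiv> (1 - \<alpha>) * res \<sigma> $ u / deg u"
  shows "step \<sigma> = \<sigma>\<lparr>est := est \<sigma> + axis u (\<alpha> * res \<sigma> $ u),
    res := (\<chi> w. if w = u then 0 else res \<sigma> $ w + (if u \<rightarrow>\<^bsub>G\<^esub> w then c else 0)),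
    queue := q @ map Some (filter (\<lambda>v. \<epsilon> * deg v \<le> res \<sigma> $ v + c \<and> Some v \<notin> set q) (nbrs u))\<rparr>"
  by (simp add: push_step_def halted_def \<sigma> push_node_def Let_def set_nbrs c_def
      fold_relax[OF distinct_nbrs not_in_nbrs] vec_eq_iff cong: if_cong)

lemma mass_step:
  assumes "queue \<sigma> = Some u # q"
  shows "mass (res (step \<sigma>)) = mass (res \<sigma>) - \<alpha> * res \<sigma> $ u"
proof -
  have "mass (res (step \<sigma>)) = (\<Sum>w\<in>UNIV. res \<sigma> $ w - (if w = u then res \<sigma> $ w else 0)
      + (if u \<rightarrow>\<^bsub>G\<^esub> w then (1 - \<alpha>) * res \<sigma> $ u / deg u else 0))"
    using not_in_nbrs[of u] by (intro sum.cong) (auto simp: step_Some[OF assms] set_nbrs)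
  also have "\<dots> = mass (res \<sigma>) - res \<sigma> $ u + (1 - \<alpha>) * res \<sigma> $ u"
    using deg_pos[of u] by (simp add: sum.distrib sum_subtractf sum.If_cases card_nbrs)
  finally show ?thesis by (simp add: algebra_simps)
qed

lemma res_le_step:
  assumes "queue \<sigma> = Some u # q" "sound \<sigma>" "w \<noteq> u"
  shows "res \<sigma> $ w \<le> res (step \<sigma>) $ w"
  using assms \<alpha>_less_1 by (simp add: step_Some[OF assms(1)] sound_def)

lemma sound_step:
  assumes q: "queue \<sigma> = Some u # q" and \<sigma>: "sound \<sigma>"
  shows "sound (step \<sigma>)"
proof -
  define c where "c = (1 - \<alpha>) * res \<sigma> $ u / deg u"
  have nonneg: "0 \<le> res \<sigma> $ w" for w
    using \<sigma> by (simp add: sound_def)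
  have c: "0 \<le> c"
    using nonneg \<alpha>_less_1 by (simp add: c_def)
  note step = step_Some[OF q, folded c_def]
  have "res \<sigma> $ u \<le> mass (res \<sigma>)"
    using nonneg by (intro member_le_sum) auto
  then have "\<alpha> * res \<sigma> $ u \<le> \<alpha> * mass (res \<sigma>)"
    using \<alpha>_pos by simp
  also have "\<dots> < mass (res \<sigma>)"
    using \<sigma> \<alpha>_less_1 by (simp add: sound_def)
  finally have "0 < mass (res (step \<sigma>))"
    by (simp add: mass_step[OF q])
  moreover have "\<forall>v. 0 \<le> res (step \<sigma>) $ v"
    using nonneg c by (simp add: step)
  moreover have "Some v \<in> set (queue (step \<sigma>))" if "v \<in> active_nodes G \<epsilon> (res (step \<sigma>))" for v
  proof -
    \<comment> \<open>The residual of \<open>u\<close> is now 0, below its positive threshold. Any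
      other active node was active before, hence queued, or received a share and was tested.\<close>
    have "v \<noteq> u"
      using that \<epsilon>_pos deg_pos[of u] by (auto simp: active_nodes_def step mult_le_0_iff)
    then show ?thesis
      using that \<sigma> by (cases "u \<rightarrow>\<^bsub>G\<^esub> v") (auto simp: active_nodes_def step sound_def q set_nbrs)
  qed
  moreover have "distinct (queue (step \<sigma>))"
    using \<sigma> distinct_nbrs[of u] by (auto simp: step sound_def q distinct_map)
  moreover have "\<alpha> *\<^sub>R res (step \<sigma>)
      = \<alpha> *\<^sub>R axis s 1 - est (step \<sigma>) + (1 - \<alpha>) *\<^sub>R (walk *v est (step \<sigma>))"
  proof -
    \<comment> \<open>The invariant is affine in \<open>est\<close>, so only the increment of
      \<open>est\<close> at \<open>u\<close> has to be accounted for.\<close>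
    have "\<alpha> *\<^sub>R res (step \<sigma>) = \<alpha> *\<^sub>R res \<sigma> - axis u (\<alpha> * res \<sigma> $ u)
        + (1 - \<alpha>) *\<^sub>R (walk *v axis u (\<alpha> * res \<sigma> $ u))"
    proof (rule vec_eq_iff[THEN iffD2, rule_format])
      fix w
      show "(\<alpha> *\<^sub>R res (step \<sigma>)) $ w = (\<alpha> *\<^sub>R res \<sigma> - axis u (\<alpha> * res \<sigma> $ u)
          + (1 - \<alpha>) *\<^sub>R (walk *v axis u (\<alpha> * res \<sigma> $ u))) $ w"
        using not_in_nbrs[of u]
        by (cases "w = u"; cases "u \<rightarrow>\<^bsub>G\<^esub> w") (simp_all add: step walk_axis axis_nth c_def set_nbrs diff_divide_distrib algebra_simps)
    qed
    also have "\<alpha> *\<^sub>R res \<sigma> = \<alpha> *\<^sub>R axis s 1 - est \<sigma> + (1 - \<alpha>) *\<^sub>R (walk *v est \<sigma>)"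
      using \<sigma> by (simp add: sound_def)
    finally show ?thesis
      by (simp add: step algebra_simps)
  qed
  ultimately show ?thesis
    unfolding sound_def by blast
qed

text \<open>A pushed node is active, so each neighbour receives at least (1 - \<alpha>) \<epsilon>:
  the degree in the threshold cancels the degree in the share. Other residuals do not drop, so
  queued nodes stay active.\<close>

lemma tight_step:
  assumes q: "queue \<sigma> = Some u # q" and \<sigma>: "sound \<sigma>" "tight \<sigma>"
  shows "tight (step \<sigma>)"
proof -
  define c where "c = (1 - \<alpha>) * res \<sigma> $ u / deg u"
  have nonneg: "0 \<le> res \<sigma> $ w" for w
    using \<sigma> by (simp add: sound_def)
  have "\<epsilon> * deg u \<le> res \<sigma> $ u"
    using \<sigma>(2) by (simp add: tight_def q active_nodes_def)
  then have "(1 - \<alpha>) * (\<epsilon> * deg u) \<le> (1 - \<alpha>) * res \<sigma> $ u"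
    using \<alpha>_less_1 by (intro mult_left_mono) auto
  then have c: "(1 - \<alpha>) * \<epsilon> \<le> c"
    using deg_pos[of u] by (simp add: c_def le_divide_eq mult.assoc)
  note step = step_Some[OF q, folded c_def]
  have "0 \<le> (1 - \<alpha>) * \<epsilon>"
    using \<alpha>_less_1 \<epsilon>_pos by simp
  with c have c0: "0 \<le> c" by linarith
  have "v \<in> active_nodes G \<epsilon> (res (step \<sigma>))" if v: "Some v \<in> set (queue (step \<sigma>))" for v
  proof -
    have "v \<noteq> u"
      using v \<sigma>(1) not_in_nbrs[of u] by (auto simp: step sound_def q)
    have "Some v \<in> set q \<Longrightarrow> \<epsilon> * deg v \<le> res \<sigma> $ v"
      using \<sigma>(2) by (simp add: tight_def q active_nodes_def)
    then show ?thesis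
      using v \<open>v \<noteq> u\<close> c0 by (auto simp: active_nodes_def step set_nbrs)
  qed
  moreover have "(1 - \<alpha>) * \<epsilon> \<le> res (step \<sigma>) $ v" if v: "v \<in> vec_support (res (step \<sigma>))" for v
  proof -
    have "v \<noteq> u"
      using v by (auto simp: vec_support_def step)
    have "res \<sigma> $ v \<noteq> 0 \<Longrightarrow> (1 - \<alpha>) * \<epsilon> \<le> res \<sigma> $ v"
      using \<sigma>(2) by (simp add: tight_def vec_support_def)
    then show ?thesis
      using v \<open>v \<noteq> u\<close> c c0 nonneg[of v] by (cases "res \<sigma> $ v = 0") (auto simp: vec_support_def step split: if_splits)
  qed
  ultimately show ?thesis
    unfolding tight_def by blast
qed

section \<open>One pass through the queue up to the dummy\<close>

lemma epoch_step: "epoch \<sigma> \<le> epoch (step \<sigma>)"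
  using step_Some[of \<sigma>] by (auto simp: push_step_def split: list.split option.split)

text \<open>New nodes are appended behind the dummy, so the nodes \<open>us\<close> ahead of it are
  popped in turn while \<open>vs\<close> grows; hence the induction on \<open>us\<close> with
  \<open>vs\<close> arbitrary.\<close>

lemma epoch_pass:
  assumes "queue \<sigma> = map Some us @ None # map Some vs" "sound \<sigma>"
  shows "\<exists>ws. queue ((step ^^ length us) \<sigma>) = None # map Some ws"
    and "sound ((step ^^ length us) \<sigma>)"
    and "tight \<sigma> \<Longrightarrow> tight ((step ^^ length us) \<sigma>)"
    and "mass (res ((step ^^ length us) \<sigma>)) \<le> mass (res \<sigma>) - \<alpha> * (\<Sum>u\<in>set us. res \<sigma> $ u)"
    and "j < length us \<Longrightarrow> \<not> halted ((step ^^ j) \<sigma>)"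
    and "j \<le> length us \<Longrightarrow> epoch ((step ^^ j) \<sigma>) = epoch \<sigma>"
  using assms
proof (induction us arbitrary: \<sigma> vs j)
  case Nil
  {
    case 1 then show ?case by simp
  next
    case 2 then show ?case by simp
  next
    case 3 then show ?case by simp
  next
    case 4 then show ?case by simp
  next
    case 5 then show ?case by simp
  next
    case 6 then show ?case by simp
  }
next
  case (Cons u us)
  have *: "\<exists>vs. queue (step \<sigma>) = map Some us @ None # map Some vs" "sound (step \<sigma>)"
    "tight \<sigma> \<Longrightarrow> tight (step \<sigma>)" "epoch (step \<sigma>) = epoch \<sigma>" "\<not> halted \<sigma>"
    "mass (res (step \<sigma>)) - \<alpha> * (\<Sum>u\<in>set us. res (step \<sigma>) $ u)
      \<le> mass (res \<sigma>) - \<alpha> * (\<Sum>u\<in>set (u # us). res \<sigma> $ u)"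
    if q: "queue \<sigma> = map Some (u # us) @ None # map Some vs" and \<sigma>: "sound \<sigma>" for \<sigma> vs
  proof -
    have q': "queue \<sigma> = Some u # map Some us @ None # map Some vs"
      using q by simp
    show "\<exists>vs. queue (step \<sigma>) = map Some us @ None # map Some vs"
      unfolding step_Some[OF q'] by (simp del: map_append add: map_append[symmetric])
    show "epoch (step \<sigma>) = epoch \<sigma>"
      by (simp add: step_Some[OF q'])
    show "sound (step \<sigma>)" "tight \<sigma> \<Longrightarrow> tight (step \<sigma>)"
      using sound_step[OF q' \<sigma>] tight_step[OF q' \<sigma>] by auto
    show "\<not> halted \<sigma>"
      by (simp add: halted_def q')
    have "distinct (u # us)"
      using \<sigma> by (auto simp: sound_def q' distinct_map)
    \<comment> \<open>Waiting nodes never lose residual, so each push removes at least \<alpha>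
      times the residual its node held at the beginning of the pass.\<close>
    moreover from this have "(\<Sum>u\<in>set us. res \<sigma> $ u) \<le> (\<Sum>u\<in>set us. res (step \<sigma>) $ u)"
      by (intro sum_mono res_le_step[OF q' \<sigma>]) auto
    ultimately show "mass (res (step \<sigma>)) - \<alpha> * (\<Sum>u\<in>set us. res (step \<sigma>) $ u)
        \<le> mass (res \<sigma>) - \<alpha> * (\<Sum>u\<in>set (u # us). res \<sigma> $ u)"
      using \<alpha>_pos by (simp add: mass_step[OF q'] algebra_simps)
  qed
  {
    case 1 then show ?case
      using *[of \<sigma> vs] Cons.IH(1)[of "step \<sigma>"] by (auto simp: funpow_swap1)
  next
    case 2 then show ?case
      using *[of \<sigma> vs] Cons.IH(2)[of "step \<sigma>"] by (auto simp: funpow_swap1)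
  next
    case 3 then show ?case
      using *[of \<sigma> vs] Cons.IH(3)[of "step \<sigma>"] by (auto simp: funpow_swap1)
  next
    case 4
    from *(1)[OF 4] obtain vs' where "queue (step \<sigma>) = map Some us @ None # map Some vs'" ..
    from Cons.IH(4)[OF this *(2)[OF 4]] *(6)[OF 4] show ?case
      by (simp add: funpow_swap1)
  next
    case 5 then show ?case
      using *[of \<sigma> vs] Cons.IH(5)[of "j - 1" "step \<sigma>"] by (cases j) (auto simp: funpow_swap1)
  next
    case 6 then show ?case
      using *[of \<sigma> vs] Cons.IH(6)[of "j - 1" "step \<sigma>"] by (cases j) (auto simp: funpow_swap1)
  }
qed

section \<open>Epochs\<close>

abbreviation run :: "nat \<Rightarrow> 'n push_state" where
  "run \<equiv> push_run G nbrs \<epsilon> \<alpha> s"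

abbreviation start :: "nat \<Rightarrow> 'n push_state" where
  "start \<equiv> epoch_state G nbrs \<epsilon> \<alpha> s"

abbreviation active :: "nat \<Rightarrow> 'n set" where
  "active t \<equiv> active_nodes G \<epsilon> (res (start t))"

abbreviation support :: "nat \<Rightarrow> 'n set" where
  "support t \<equiv> vec_support (res (start t))"

abbreviation ratio :: "nat \<Rightarrow> real" where
  "ratio t \<equiv> vol G (active t) / vol G (support t)"

lemma run_Suc: "run (Suc k) = step (run k)"
  and run_add: "run (k + j) = (step ^^ j) (run k)"
  by (simp_all add: push_run_def funpow_add add.commute[of k])

lemma epoch_run_mono: "j \<le> k \<Longrightarrow> epoch (run j) \<le> epoch (run k)"
  by (rule lift_Suc_mono_le) (simp_all add: run_Suc epoch_step)

lemma sound_init: "sound (init_state s)"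
  using \<epsilon>_pos deg_pos
  by (auto simp: sound_def init_state_def active_nodes_def axis_nth mult_le_0_iff split: if_splits
      dest: leD)

lemma tight_init:
  assumes "\<epsilon> * deg s \<le> 1"
  shows "tight (init_state s)"
proof -
  have "(1 - \<alpha>) * \<epsilon> \<le> 1 * (\<epsilon> * deg s)"
    using \<alpha>_pos \<alpha>_less_1 \<epsilon>_pos deg_ge_1[of s] by (intro mult_mono) auto
  then show ?thesis
    using assms by (auto simp: tight_def init_state_def active_nodes_def vec_support_def axis_nth)
qed

text \<open>Relational form of \<open>epoch_state\<close>: \<open>k\<close> is the first time at
  which epoch \<open>t\<close> begins or the algorithm has halted. Asking for \<open>< t\<close>
  rather than \<open>\<noteq> t\<close> at earlier times lets the condition carry over to the next
  epoch.\<close>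

definition starts :: "nat \<Rightarrow> nat \<Rightarrow> bool" where
  "starts t k \<longleftrightarrow> sound (run k) \<and> (\<exists>us. queue (run k) = map Some us @ [None])
     \<and> (epoch (run k) = t \<or> halted (run k)) \<and> (\<forall>j<k. epoch (run j) < t \<and> \<not> halted (run j))"

lemma starts_0: "starts 0 0"
  by (auto simp: starts_def push_run_def sound_init)
    (auto simp: init_state_def intro: exI[of _ "[s]"])

lemma start_eq:
  assumes "starts t k"
  shows "start t = run k"
proof -
  have "(LEAST k. epoch (run k) = t \<or> halted (run k)) = k"
    using assms by (intro Least_equality) (auto simp: starts_def intro: leI)
  then show ?thesis
    by (simp add: epoch_state_def)
qed

text \<open>All nodes ahead of the dummy are popped. If none was queued behind it, the algorithm has
  halted and the counter stays; otherwise one more step re-appends the dummy and increments the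
  counter.\<close>

lemma starts_Suc:
  assumes "starts t k"
  shows "\<exists>k'. starts (Suc t) k' \<and> (tight (run k) \<longrightarrow> tight (run k'))
    \<and> mass (res (run k')) \<le> mass (res (run k)) - \<alpha> * (\<Sum>u\<in>active_nodes G \<epsilon> (res (run k)). res (run k) $ u)"
proof -
  let ?A = "active_nodes G \<epsilon> (res (run k))"
  have sound: "sound (run k)" and before: "\<And>j. j < k \<Longrightarrow> epoch (run j) < t \<and> \<not> halted (run j)"
    using assms by (auto simp: starts_def)
  show ?thesis
  proof (cases "halted (run k)")
    case True
    \<comment> \<open>After halting, the same \<open>k\<close> serves for the next epoch, and the
      claimed decrease is 0.\<close>
    then have "?A = {}"
      using sound by (auto simp: sound_def halted_def)
    then show ?thesis
      using True assms by (intro exI[of _ k]) (auto simp: starts_def less_SucI)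
  next
    case False
    then obtain us where us: "queue (run k) = map Some us @ None # map Some []" and t: "epoch (run k) = t"
      using assms by (auto simp: starts_def)
    note pass = epoch_pass[OF us sound, folded run_add]
    define m where "m = k + length us"
    obtain ws where ws: "queue (run m) = None # map Some ws"
      using pass(1) by (auto simp: m_def)
    have "?A \<subseteq> set us"
      using sound by (auto simp: sound_def us)
    \<comment> \<open>The queue may also hold an inactive start node; residuals are nonnegative, so
      dropping it only weakens the bound.\<close>
    then have "(\<Sum>u\<in>?A. res (run k) $ u) \<le> (\<Sum>u\<in>set us. res (run k) $ u)"
      using sound by (intro sum_mono2) (auto simp: sound_def)
    then have "\<alpha> * (\<Sum>u\<in>?A. res (run k) $ u) \<le> \<alpha> * (\<Sum>u\<in>set us. res (run k) $ u)"
      using \<alpha>_pos by simp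
    then have mass: "mass (res (run m)) \<le> mass (res (run k)) - \<alpha> * (\<Sum>u\<in>?A. res (run k) $ u)"
      using pass(4) by (simp add: m_def)
    have epoch: "epoch (run j) \<le> t" if "j \<le> m" for j
      using before[of j] pass(6)[of "j - k"] that t by (cases "j < k") (auto simp: m_def)
    have running: "\<not> halted (run j)" if "j < m" for j
      using before[of j] pass(5)[of "j - k"] that by (cases "j < k") (auto simp: m_def)
    show ?thesis
    proof (cases "halted (run m)")
      case True
      then have "starts (Suc t) m"
        using pass(2) ws epoch running
        by (auto simp: starts_def halted_def m_def less_Suc_eq_le intro!: exI[of _ "[]"])
      then show ?thesis
        using False mass pass(3) by (intro exI[of _ m]) (auto simp: m_def)
    next
      case False
      have step: "run (Suc m) = (run m)\<lparr>queue := map Some ws @ [None], epoch := Suc (epoch (run m))\<rparr>"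
        using False by (simp add: run_Suc push_step_def ws)
      have "sound (run (Suc m))"
        using pass(2) unfolding step by (auto simp: sound_def m_def ws[unfolded m_def])
      moreover have "epoch (run m) = t"
        using pass(6)[of "length us"] t by (simp add: m_def)
      moreover have "\<forall>j<Suc m. epoch (run j) < Suc t \<and> \<not> halted (run j)"
        using epoch running False by (auto simp: less_Suc_eq_le le_less[of _ m])
      ultimately have "starts (Suc t) (Suc m)"
        unfolding starts_def by (auto simp: step)
      moreover have "tight (run k) \<longrightarrow> tight (run (Suc m))"
        using pass(3) unfolding step by (auto simp: tight_def m_def ws[unfolded m_def])
      ultimately show ?thesis
        using \<open>\<not> halted (run k)\<close> mass by (intro exI[of _ "Suc m"]) (simp add: step)
    qed
  qed
qed

lemma ex_starts: "\<exists>k. starts t k"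
  by (induction t) (use starts_0 starts_Suc in blast)+

lemma sound_start: "sound (start t)"
  by (metis ex_starts start_eq starts_def)

lemma start_0: "start 0 = init_state s"
  using start_eq[OF starts_0] by (simp add: push_run_def)

lemma start_Suc:
  shows "tight (start t) \<Longrightarrow> tight (start (Suc t))"
    and "mass (res (start (Suc t)))
      \<le> mass (res (start t)) - \<alpha> * (\<Sum>u\<in>active t. res (start t) $ u)"
proof -
  obtain k where k: "starts t k"
    using ex_starts by blast
  from starts_Suc[OF k] obtain k' where k': "starts (Suc t) k'"
    "tight (run k) \<longrightarrow> tight (run k')"
    "mass (res (run k'))
      \<le> mass (res (run k)) - \<alpha> * (\<Sum>u\<in>active_nodes G \<epsilon> (res (run k)). res (run k) $ u)"
    by blast
  show "tight (start t) \<Longrightarrow> tight (start (Suc t))"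
    "mass (res (start (Suc t)))
      \<le> mass (res (start t)) - \<alpha> * (\<Sum>u\<in>active t. res (start t) $ u)"
    using k'(2,3) by (simp_all add: start_eq[OF k] start_eq[OF k'(1)])
qed

section \<open>Contraction of the residual mass\<close>

lemma vol_nonneg: "0 \<le> vol G A"
  by (simp add: vol_def sum_nonneg)

lemma active_subset_support: "active t \<subseteq> support t"
proof
  fix u assume "u \<in> active t"
  moreover have "0 < \<epsilon> * deg u"
    using \<epsilon>_pos deg_pos by simp
  ultimately show "u \<in> support t"
    by (auto simp: active_nodes_def vec_support_def)
qed

lemma vol_pos: "A \<noteq> {} \<Longrightarrow> 0 < vol G A"
  unfolding vol_def using deg_pos by (intro sum_pos) auto

lemma support_nonempty: "support t \<noteq> {}"
proof
  assume "support t = {}"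
  then have "mass (res (start t)) = 0"
    by (simp add: vec_support_def)
  then show False
    using sound_start[of t] by (simp add: sound_def)
qed

text \<open>Active nodes carry at least \<open>\<epsilon>\<close> residual per unit of volume, all others less, so the active
  nodes hold at least their proportional share of the residual.\<close>

lemma ratio_mass_le: "ratio t * mass (res (start t)) \<le> (\<Sum>u\<in>active t. res (start t) $ u)"
proof -
  define A B where "A = active t" and "B = support t - active t"
  let ?r = "\<lambda>C. \<Sum>u\<in>C. res (start t) $ u"
  have AB: "support t = A \<union> B" "A \<inter> B = {}"
    using active_subset_support by (auto simp: A_def B_def)
  have "mass (res (start t)) = ?r (support t)"
    by (intro sum.mono_neutral_right) (auto simp: vec_support_def)
  also have "\<dots> = ?r A + ?r B"
    unfolding AB(1) using AB(2) by (intro sum.union_disjoint) auto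
  finally have m: "mass (res (start t)) = ?r A + ?r B" .
  have vol: "vol G (support t) = vol G A + vol G B"
    unfolding AB(1) vol_def using AB(2) by (intro sum.union_disjoint) auto
  have "\<epsilon> * vol G A \<le> ?r A"
    unfolding vol_def sum_distrib_left by (intro sum_mono) (simp add: A_def active_nodes_def)
  moreover have "?r B \<le> \<epsilon> * vol G B"
    unfolding vol_def sum_distrib_left by (intro sum_mono) (auto simp: B_def active_nodes_def)
  \<comment> \<open>Cross-multiplied, the two density bounds meet at the common term
    \<open>\<epsilon> * vol G A * vol G B\<close>.\<close>
  ultimately have "vol G A * ?r B \<le> vol G A * (\<epsilon> * vol G B)" "(\<epsilon> * vol G A) * vol G B \<le> ?r A * vol G B"
    using vol_nonneg by (auto intro: mult_left_mono mult_right_mono)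
  then have "vol G A * mass (res (start t)) \<le> ?r A * vol G (support t)"
    unfolding m vol by (simp add: algebra_simps)
  then show ?thesis
    using vol_pos[OF support_nonempty, of t] by (simp add: A_def field_simps)
qed

lemma mass_contraction: "mass (res (start (Suc t))) \<le> (1 - \<alpha> * ratio t) * mass (res (start t))"
proof -
  have "\<alpha> * (ratio t * mass (res (start t))) \<le> \<alpha> * (\<Sum>u\<in>active t. res (start t) $ u)"
    using ratio_mass_le \<alpha>_pos by (intro mult_left_mono) auto
  with start_Suc(2)[of t] show ?thesis
    by (simp add: algebra_simps)
qed

lemma l1_norm_start: "l1_norm (est (start t) - ppr G \<alpha> s) = mass (res (start t))"
  using sound_start[of t] by (intro l1_norm_ppr_diff) (auto simp: sound_def)

text \<open>The contraction is iterated from mass 1, with 1 - a \<le> exp (- a) for each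
  factor.\<close>

lemma mass_le_exp: "mass (res (start t)) \<le> exp (- (\<alpha> * (\<Sum>i<t. ratio i)))"
proof (induction t)
  case 0
  show ?case by (simp add: start_0 init_state_def axis_nth)
next
  case (Suc t)
  have "0 \<le> mass (res (start t))"
    using sound_start[of t] by (simp add: sound_def)
  then have "(1 - \<alpha> * ratio t) * mass (res (start t)) \<le> exp (- (\<alpha> * ratio t)) * mass (res (start t))"
    using exp_ge_add_one_self[of "- (\<alpha> * ratio t)"] by (intro mult_right_mono) auto
  also have "\<dots> \<le> exp (- (\<alpha> * ratio t)) * exp (- (\<alpha> * (\<Sum>i<t. ratio i)))"
    using Suc.IH by simp
  finally show ?case
    using mass_contraction[of t] by (simp add: exp_add[symmetric] algebra_simps)
qed

lemma tight_start:
  assumes "\<epsilon> * deg s \<le> 1"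
  shows "tight (start t)"
  by (induction t) (use start_0 tight_init[OF assms] start_Suc(1) in auto)

section \<open>Termination and total work\<close>

text \<open>Without halting, every epoch begins with a queued node, which tightness makes active, so
  each epoch costs at least \<alpha> \<epsilon> of mass; but the mass stays positive.\<close>

lemma eventually_halted:
  assumes "\<epsilon> * deg s \<le> 1"
  shows "\<exists>k. halted (run k)"
proof (rule ccontr)
  assume none: "\<nexists>k. halted (run k)"
  have "mass (res (start t)) \<le> 1 - real t * (\<alpha> * \<epsilon>)" for t
  proof (induction t)
    case 0
    show ?case by (simp add: start_0 init_state_def axis_nth)
  next
    case (Suc t)
    obtain k where k: "starts t k"
      using ex_starts by blast
    then obtain us where us: "queue (start t) = map Some us @ [None]" and "\<not> halted (start t)"
      using none by (auto simp: starts_def start_eq[OF k])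
    then obtain u where u: "u \<in> set us"
      by (cases us) (auto simp: halted_def)
    then have "u \<in> active t"
      using tight_start[OF assms, of t] us by (auto simp: tight_def)
    have "\<epsilon> * 1 \<le> \<epsilon> * deg u"
      using \<epsilon>_pos deg_ge_1 by (intro mult_left_mono) auto
    also have "\<dots> \<le> res (start t) $ u"
      using \<open>u \<in> active t\<close> by (simp add: active_nodes_def)
    also have "\<dots> \<le> (\<Sum>u\<in>active t. res (start t) $ u)"
      using \<open>u \<in> active t\<close> sound_start[of t] by (intro member_le_sum) (auto simp: sound_def)
    finally have "\<alpha> * \<epsilon> \<le> \<alpha> * (\<Sum>u\<in>active t. res (start t) $ u)"
      using \<alpha>_pos by simp
    then show ?case
      using Suc.IH start_Suc(2)[of t] by (simp add: algebra_simps)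
  qed
  moreover obtain t where "1 < real t * (\<alpha> * \<epsilon>)"
    using reals_Archimedean3[of "\<alpha> * \<epsilon>"] \<alpha>_pos \<epsilon>_pos by auto
  ultimately have "mass (res (start t)) < 0"
    by (metis diff_less_0_iff_less le_less_trans)
  then show False
    using sound_start[of t] by (simp add: sound_def)
qed

text \<open>The start node is pushed even if it is not active; then no node becomes active and the
  algorithm halts at once.\<close>

lemma halted_run_1:
  assumes "1 < \<epsilon> * deg s"
  shows "halted (run 1)" "epoch (run 1) = 0"
proof -
  \<comment> \<open>The share passed on by the start node is below \<open>1 / deg s\<close>, hence
    below \<epsilon>, and every threshold is at least \<epsilon>.\<close>
  have "(1 - \<alpha>) / deg s < \<epsilon> * deg v" for v
  proof -
    have "(1 - \<alpha>) / deg s < 1 / deg s"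
      using \<alpha>_pos deg_pos[of s] by (simp add: divide_strict_right_mono)
    also have "\<dots> \<le> \<epsilon>"
      using assms deg_pos[of s] by (simp add: field_simps)
    also have "\<dots> * 1 \<le> \<epsilon> * deg v"
      using \<epsilon>_pos deg_ge_1 by (intro mult_left_mono) auto
    finally show ?thesis by simp
  qed
  then have "filter (\<lambda>v. \<epsilon> * deg v \<le> axis s 1 $ v + (1 - \<alpha>) * axis s 1 $ s / deg s \<and> Some v \<notin> set [None]) (nbrs s) = []"
    using not_in_nbrs[of s] by (auto simp: filter_empty_conv axis_nth not_le)
  moreover have "queue (run 0) = Some s # [None]"
    by (simp add: push_run_def init_state_def)
  ultimately show "halted (run 1)" "epoch (run 1) = 0"
    using step_Some[of "run 0" s "[None]"] run_Suc[of 0]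
    by (simp_all add: halted_def push_run_def init_state_def)
qed

section \<open>Number of epochs and the work bound\<close>

abbreviation T :: nat where
  "T \<equiv> num_epochs G nbrs \<epsilon> \<alpha> s"

lemma ex_halted: "\<exists>k. halted (run k)"
  using eventually_halted halted_run_1(1) by (cases "\<epsilon> * deg s \<le> 1") auto

text \<open>\<open>T\<close> is one more than the epoch counter at the halting time, so the counter
  never reaches \<open>T\<close> and \<open>epoch_state\<close> falls back to the final
  state.\<close>

lemma halted_start_T: "halted (start T)"
proof -
  define K where "K = (LEAST k. halted (run k))"
  have K: "halted (run K)"
    unfolding K_def using ex_halted by (rule LeastI_ex)
  have "epoch (run k) \<noteq> T" if "k < K" for k
    using epoch_run_mono[of k K] that by (simp add: num_epochs_def K_def)
  then have "(LEAST k. epoch (run k) = T \<or> halted (run k)) = K"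
    using K not_less_Least[of _ "\<lambda>k. halted (run k)", folded K_def]
    by (intro Least_equality) (auto intro: leI)
  then show ?thesis
    using K by (simp add: epoch_state_def)
qed

lemma T_pos: "0 < T"
  by (simp add: num_epochs_def)

lemma active_T: "active T = {}"
  using sound_start[of T] halted_start_T by (auto simp: sound_def halted_def)

lemma ratio_nonneg: "0 \<le> ratio t"
  by (simp add: vol_nonneg)

lemma ratio_sum_bound:
  assumes "\<epsilon> * deg s \<le> 1"
  shows "\<alpha> * (\<Sum>t<T. ratio t) \<le> ln (1 / ((1 - \<alpha>) * real (card (support T))) / \<epsilon>)"
proof -
  \<comment> \<open>\<open>c\<close> is the lower bound on the final mass given by tightness; its
    inverse is the argument of \<open>ln\<close>.\<close>
  define c where "c = (1 - \<alpha>) * \<epsilon> * real (card (support T))"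
  have "0 < c"
    using \<alpha>_less_1 \<epsilon>_pos support_nonempty[of T] by (simp add: c_def card_gt_0_iff)
  have "c \<le> (\<Sum>v\<in>support T. res (start T) $ v)"
    using sum_mono[of "support T" "\<lambda>_. (1 - \<alpha>) * \<epsilon>" "\<lambda>v. res (start T) $ v"]
      tight_start[OF assms, of T] by (simp add: c_def tight_def mult.commute)
  also have "\<dots> = mass (res (start T))"
    by (intro sum.mono_neutral_left) (auto simp: vec_support_def)
  also note mass_le_exp
  finally have "ln c \<le> ln (exp (- (\<alpha> * (\<Sum>t<T. ratio t))))"
    using \<open>0 < c\<close> by (subst ln_le_cancel_iff) auto
  moreover have "1 / ((1 - \<alpha>) * real (card (support T))) / \<epsilon> = inverse c"
    by (simp add: c_def field_simps)
  ultimately show ?thesis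
    using \<open>0 < c\<close> by (simp add: ln_inverse)
qed

text \<open>An arbitrary \<open>J\<close> serves both index ranges at once. The factors
  \<open>1 / real T\<close> cancel, and it remains to compare \<alpha> times the sum of ratios with
  the logarithm.\<close>

lemma work_bound:
  assumes J: "J \<subseteq> {..T}"
  shows "(\<Sum>t\<in>J. vol G (active t))
    \<le> (1 / real T * (\<Sum>t\<in>J. vol G (active t))) / (\<alpha> * (1 / real T * (\<Sum>t\<in>J. ratio t)))
      * ln (1 / ((1 - \<alpha>) * real (card (support T))) / \<epsilon>)"
    (is "?V \<le> 1 / real T * ?V / (\<alpha> * (1 / real T * ?\<Gamma>)) * ?L")
proof (cases "\<forall>t\<in>J. active t = {}")
  case True
  \<comment> \<open>Both sides are 0 whatever the sign of the logarithm; the quotient on the right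
    is 0 / 0 = 0.\<close>
  then show ?thesis by (simp add: vol_def)
next
  case False
  then obtain t where t: "t \<in> J" "active t \<noteq> {}" by blast
  have fin: "finite J"
    using J finite_subset by blast
  have "0 < ratio t"
    using t vol_pos support_nonempty by simp
  then have \<Gamma>: "0 < ?\<Gamma>"
    using t(1) fin ratio_nonneg by (intro sum_pos2[of J t])
  \<comment> \<open>An inactive start node would give \<open>T = 1\<close> with no active node at
    epochs 0 and 1, contradicting the choice of \<open>t\<close>.\<close>
  have init: "\<epsilon> * deg s \<le> 1"
  proof (rule ccontr)
    assume "\<not> \<epsilon> * deg s \<le> 1"
    then have init: "1 < \<epsilon> * deg s" by simp
    define K where "K = (LEAST k. halted (run k))"
    have "K \<le> 1"
      unfolding K_def by (rule Least_le) (rule halted_run_1(1)[OF init])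
    then have "epoch (run K) = 0"
      using epoch_run_mono[of K 1] halted_run_1(2)[OF init] by simp
    then have "T = 1" by (simp add: num_epochs_def K_def)
    moreover have "active 0 = {}"
      using init \<epsilon>_pos deg_pos
      by (auto simp: start_0 init_state_def active_nodes_def axis_nth mult_le_0_iff not_le split: if_splits dest: leD)
    ultimately have "active t = {}"
      using t(1) J active_T by (cases t) auto
    with t show False by simp
  qed
  \<comment> \<open>Ratios are nonnegative, so the range may be enlarged; the term at
    \<open>T\<close> is 0.\<close>
  have "?\<Gamma> \<le> (\<Sum>t\<le>T. ratio t)"
    using J ratio_nonneg by (intro sum_mono2) auto
  also have "\<dots> = (\<Sum>t<T. ratio t)"
    using active_T by (simp add: lessThan_Suc_atMost[symmetric] vol_def)
  finally have "\<alpha> * ?\<Gamma> \<le> \<alpha> * (\<Sum>t<T. ratio t)"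
    using \<alpha>_pos by simp
  also have "\<dots> \<le> ?L"
    by (rule ratio_sum_bound[OF init])
  finally have "?V * (\<alpha> * ?\<Gamma>) \<le> ?V * ?L"
    by (intro mult_left_mono) (auto intro: sum_nonneg vol_nonneg)
  then have "?V \<le> ?V / (\<alpha> * ?\<Gamma>) * ?L"
    using \<Gamma> \<alpha>_pos by (simp add: field_simps)
  also have "?V / (\<alpha> * ?\<Gamma>) = 1 / real T * ?V / (\<alpha> * (1 / real T * ?\<Gamma>))"
    using T_pos by simp
  finally show ?thesis .
qed

end

text \<open>Epochs are numbered from 0, so those executed are 0, ..., T - 1. The work bound is given
  for this range and for 1, ..., T, where index T is the final state, without active nodes.\<close>

theorem theorem2:
  fixes G :: "('n::finite, 'b) pre_digraph"
    and nbrs :: "'n \<Rightarrow> 'n list"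
    and \<alpha> \<epsilon> :: real
    and s :: 'n
    and xstar :: "real^'n"
    and x r :: "nat \<Rightarrow> real^'n"
    and S I :: "nat \<Rightarrow> 'n set"
    and \<gamma> :: "nat \<Rightarrow> real"
    and T :: nat
    and C :: real
  assumes "digraph G" and "verts G = UNIV"
    and "\<And>u. out_degree G u \<ge> 1"
    and "adjacency_lists G nbrs"
    and "0 < \<alpha>" and "\<alpha> < 1" and "0 < \<epsilon>"
  defines "xstar \<equiv> ppr G \<alpha> s"
    and "x \<equiv> \<lambda>t. est (epoch_state G nbrs \<epsilon> \<alpha> s t)"
    and "r \<equiv> \<lambda>t. res (epoch_state G nbrs \<epsilon> \<alpha> s t)"
    and "S \<equiv> \<lambda>t. active_nodes G \<epsilon> (r t)"
    and "I \<equiv> \<lambda>t. vec_support (r t)"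
    and "\<gamma> \<equiv> \<lambda>t. vol G (S t) / vol G (I t)"
    and "T \<equiv> num_epochs G nbrs \<epsilon> \<alpha> s"
    and "C \<equiv> 1 / ((1 - \<alpha>) * real (card (I T)))"
  shows "(\<forall>t. l1_norm (x (Suc t) - xstar) \<le> (1 - \<alpha> * \<gamma> t) * l1_norm (x t - xstar))
    \<and> (\<Sum>t=1..T. vol G (S t))
        \<le> (1 / real T * (\<Sum>t=1..T. vol G (S t)))
            / (\<alpha> * (1 / real T * (\<Sum>t=1..T. \<gamma> t))) * ln (C / \<epsilon>)
    \<and> (\<Sum>t<T. vol G (S t))
        \<le> (1 / real T * (\<Sum>t<T. vol G (S t)))
            / (\<alpha> * (1 / real T * (\<Sum>t<T. \<gamma> t))) * ln (C / \<epsilon>)"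
proof -
  interpret digraph G by fact
  interpret forward_push G nbrs \<alpha> \<epsilon> s
    using assms(3-7) by unfold_locales
  show ?thesis
    unfolding C_def \<gamma>_def S_def I_def r_def x_def xstar_def T_def l1_norm_start
    by (intro conjI allI mass_contraction work_bound) auto
qed

end
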